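(* Let $\alpha$ be a positive rational number and let $\mathcal O_\alpha$ be a canonical optimal factorization tree for $\alpha$. Then $\mathcal O_\alpha$ is both an optimal factorization tree and a primitive factorization tree for $\alpha$.
   Context: Write $\alpha=a/b$ with $a,b$ coprime positive integers. Let $p_1\ge\cdots\ge p_N$ be the primes dividing $ab$, listed with multiplicity. Put $\gamma(i)=1$ if $p_i\mid a$, $\gamma(i)=-1$ if $p_i\mid b$, and $\alpha_n=\prod_{i=1}^n p_i^{\gamma(i)}$ for $0\le n\le N$. A factorization of a positive rational $\beta$ is a sequence $(a_1/b_1,a_2/b_2,\dots)$ with $a_i,b_i$ positive integers, $a_i=b_i=1$ for all but finitely many $i$, $\prod_i a_i/b_i=\beta$, $\max\{a_i,b_i\}\ge\max\{a_{i+1},b_{i+1}\}$ for all $i$, and $\gcd(a_i,b_j)=1$ for all $i,j$; it is primitive if each $\max\{a_i,b_i\}$ is prime or $1$. For nonzero algebraic $\beta$, $m(\beta)$ is its logarithmic Mahler measure ($m(a/b)=\log\max\{a,b\}$ for $a/b$ in lowest terms) and $m_t(\beta)=\inf\{(\sum_{n=1}^M m(\beta_n)^t)^{1/t}: M\in\mathbb N,\ \beta_n\in\overline{\mathbb Q}^\times,\ \beta=\prod\beta_n\}$. A factorization $(a_i/b_i)$ of $\beta$ is optimal if there is $T>0$ with $m_t(\beta)=(\sum_i m(a_i/b_i)^t)^{1/t}$ for all $t\ge T$. Let $\mathfrak F_\alpha$, $\mathfrak P_\alpha$, $\mathfrak O_\alpha$ be the sets of all, all primitive, and all optimal factorizations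 of $\alpha_n$, $0\le n\le N$. For $0\le n<N$, a factorization $(a_i/b_i)$ of $\alpha_n$ is a direct subfactorization of a factorization $(c_i/d_i)$ of $\alpha_{n+1}$ if either $p_{n+1}\mid a$ and for some $k$: $d_i=b_i$ for all $i$, $c_i=a_i$ for $i\ne k$, $c_k=a_kp_{n+1}$; or $p_{n+1}\mid b$ and for some $k$: $c_i=a_i$ for all $i$, $d_i=b_i$ for $i\ne k$, $d_k=b_kp_{n+1}$. A factorization tree for $\alpha$ is a pair $(T,\nu)$ with $T$ a rooted tree and $\nu:V(T)\to\mathfrak F_\alpha$, with parenting map $\phi$ and $\mathcal C(r)$ the set of children of $r$, such that: (1) root $r_0$ has $\nu(r_0)=(1,1,\dots)$; (2) if $n<N$ and $\nu(r)$ is a factorization of $\alpha_n$ then $r$ has a child; (3) $\nu(r)=\nu(s)$ and $\phi(r)=\phi(s)$ imply $r=s$; (4) for non-root $r$, $\nu(\phi(r))$ is a direct subfactorization of $\nu(r)$. It is primitive if $\nu(V(T))\subseteq\mathfrak P_\alpha$ and optimal if $\mathfrak O_\alpha\subseteq\nu(V(T))$. For $0\le n<N$ and a factorization $\mathbf A=(a_1/b_1,\dots,a_\ell/b_\ell,1,1,\dots)$ of $\alpha_n$ with $a_\ell/b_\ell\ne1$ ($\ell=0$ if $\mathbf A=(1,1,\dots)$): if $p_{n+1}\mid a$, $\delta(\mathbf A)$ is the set of sequences obtained from $\mathbf A$ by replacing $a_k/b_k$ by $a_kp_{n+1}/b_k$ for some $k$ with $a_kp_{n+1}<b_k$, and $\epsilon(\mathbf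 A)=\{(a_1/b_1,\dots,a_\ell/b_\ell,p_{n+1}/1,1,\dots)\}$; if $p_{n+1}\mid b$, $\delta(\mathbf A)$ consists of sequences obtained by replacing $a_k/b_k$ by $a_k/(b_kp_{n+1})$ for some $k$ with $b_kp_{n+1}<a_k$, and $\epsilon(\mathbf A)=\{(a_1/b_1,\dots,a_\ell/b_\ell,1/p_{n+1},1,\dots)\}$. A canonical optimal factorization tree is a factorization tree such that for every non-leaf vertex $r$, $\nu(\mathcal C(r))=\delta(\nu(r))$ if $\delta(\nu(r))\neq\emptyset$ and $\nu(\mathcal C(r))=\epsilon(\nu(r))$ otherwise. *)

theory Defs
  imports
    "HOL-Computational_Algebra.Computational_Algebra"
    "HOL-Analysis.Analysis"
    "Berlekamp_Zassenhaus.Mahler_Measure"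
    "Graph_Theory.Graph_Theory"
begin

section \<open>Mahler measure and its $t$-metric version\<close>

text \<open>
  The minimal polynomial over the integers (irreducible in \<open>\<int>[x]\<close>, hence primitive, with positive
  leading coefficient); meaningful only for algebraic \<open>\<beta>\<close>. The library's \<open>mahler_measure\<close> is the
  multiplicative Mahler measure of an integer polynomial.
\<close>

definition int_min_poly :: "complex \<Rightarrow> int poly" where
  "int_min_poly \<beta> =
     (THE f. irreducible f \<and> lead_coeff f > 0 \<and> poly (map_poly of_int f) \<beta> = 0)"

definition log_mahler :: "complex \<Rightarrow> real" where
  "log_mahler \<beta> = ln (mahler_measure (int_min_poly \<beta>))"

text \<open>The algebraic closure of \<open>\<rat>\<close> is taken inside \<open>\<complex>\<close>; only \<open>t > 0\<close> is meaningful.\<close>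

definition metric_mahler :: "real \<Rightarrow> complex \<Rightarrow> real" where
  "metric_mahler t \<beta> =
     Inf {(\<Sum>n<M. log_mahler (x n) powr t) powr (1 / t) | (M :: nat) (x :: nat \<Rightarrow> complex).
            (\<forall>n<M. algebraic (x n) \<and> x n \<noteq> 0) \<and> \<beta> = (\<Prod>n<M. x n)}"


section \<open>Prime data of a positive rational\<close>

definition num :: "rat \<Rightarrow> nat" where "num \<alpha> = nat (fst (quotient_of \<alpha>))"
definition den :: "rat \<Rightarrow> nat" where "den \<alpha> = nat (snd (quotient_of \<alpha>))"

text \<open>All lists and sequences are indexed from 0, so the prime $p_{n+1}$ is \<open>primes_of \<alpha> ! n\<close>.\<close>

definition primes_of :: "rat \<Rightarrow> nat list" where
  "primes_of \<alpha> = rev (sorted_list_of_multiset (prime_factorization (num \<alpha> * den \<alpha>)))"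

definition num_primes :: "rat \<Rightarrow> nat" where
  "num_primes \<alpha> = length (primes_of \<alpha>)"

definition gamma_exp :: "rat \<Rightarrow> nat \<Rightarrow> int" where
  "gamma_exp \<alpha> i = (if primes_of \<alpha> ! i dvd num \<alpha> then 1 else - 1)"

definition partial :: "rat \<Rightarrow> nat \<Rightarrow> rat" where
  "partial \<alpha> n = (\<Prod>i<n. of_nat (primes_of \<alpha> ! i) powi gamma_exp \<alpha> i)"


section \<open>Factorizations\<close>

text \<open>
  The sequence $(a_1/b_1, a_2/b_2, \ldots)$ is encoded by the pairs \<open>(a\<^sub>i, b\<^sub>i)\<close>. Coprimality makes
  every $a_i/b_i$ reduced, so equality of pair sequences is equality of sequences of rationals.
\<close>

type_synonym fact_seq = "nat \<Rightarrow> nat \<times> nat"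

abbreviation nm :: "fact_seq \<Rightarrow> nat \<Rightarrow> nat" where "nm A i \<equiv> fst (A i)"
abbreviation dn :: "fact_seq \<Rightarrow> nat \<Rightarrow> nat" where "dn A i \<equiv> snd (A i)"

definition one_seq :: fact_seq where "one_seq = (\<lambda>_. (1, 1))"

definition supp :: "fact_seq \<Rightarrow> nat set" where "supp A = {i. A i \<noteq> (1, 1)}"

definition factorization :: "rat \<Rightarrow> fact_seq \<Rightarrow> bool" where
  "factorization \<beta> A \<longleftrightarrow>
     (\<forall>i. nm A i > 0 \<and> dn A i > 0) \<and>
     finite (supp A) \<and>
     (\<Prod>i\<in>supp A. of_nat (nm A i) / of_nat (dn A i)) = \<beta> \<and>
     (\<forall>i. max (nm A i) (dn A i) \<ge> max (nm A (Suc i)) (dn A (Suc i))) \<and>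
     (\<forall>i j. coprime (nm A i) (dn A j))"

definition primitive_factorization :: "rat \<Rightarrow> fact_seq \<Rightarrow> bool" where
  "primitive_factorization \<beta> A \<longleftrightarrow>
     factorization \<beta> A \<and> (\<forall>i. prime (max (nm A i) (dn A i)) \<or> max (nm A i) (dn A i) = 1)"

text \<open>Terms outside the support contribute $m(1)^t = 0$ and are omitted from the sum.\<close>

definition optimal_factorization :: "rat \<Rightarrow> fact_seq \<Rightarrow> bool" where
  "optimal_factorization \<beta> A \<longleftrightarrow>
     factorization \<beta> A \<and>
     (\<exists>T>0. \<forall>t\<ge>T. metric_mahler t (of_rat \<beta>) =
        (\<Sum>i\<in>supp A. log_mahler (of_nat (nm A i) / of_nat (dn A i)) powr t) powr (1 / t))"

definition all_facts :: "rat \<Rightarrow> fact_seq set" where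
  "all_facts \<alpha> = {A. \<exists>n\<le>num_primes \<alpha>. factorization (partial \<alpha> n) A}"

definition primitive_facts :: "rat \<Rightarrow> fact_seq set" where
  "primitive_facts \<alpha> = {A. \<exists>n\<le>num_primes \<alpha>. primitive_factorization (partial \<alpha> n) A}"

definition optimal_facts :: "rat \<Rightarrow> fact_seq set" where
  "optimal_facts \<alpha> = {A. \<exists>n\<le>num_primes \<alpha>. optimal_factorization (partial \<alpha> n) A}"

definition direct_subfactorization :: "rat \<Rightarrow> fact_seq \<Rightarrow> fact_seq \<Rightarrow> bool" where
  "direct_subfactorization \<alpha> A C \<longleftrightarrow>
     (\<exists>n<num_primes \<alpha>. let p = primes_of \<alpha> ! n in
        factorization (partial \<alpha> n) A \<and> factorization (partial \<alpha> (Suc n)) C \<and>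
        ((p dvd num \<alpha> \<and>
            (\<exists>k. (\<forall>i. dn C i = dn A i) \<and> (\<forall>i. i \<noteq> k \<longrightarrow> nm C i = nm A i) \<and> nm C k = nm A k * p)) \<or>
         (p dvd den \<alpha> \<and>
            (\<exists>k. (\<forall>i. nm C i = nm A i) \<and> (\<forall>i. i \<noteq> k \<longrightarrow> dn C i = dn A i) \<and> dn C k = dn A k * p))))"


section \<open>Rooted trees\<close>

text \<open>
  Undirected simple graphs are loop-free symmetric digraphs without parallel arcs, possibly infinite.
  The constant \<open>tree\<close> of the graph library only forbids directed cycles (so it accepts a
  directed diamond and rejects every symmetric digraph with an arc); here a tree is a graph in
  which any two vertices are joined by exactly one path.
\<close>

definition rooted_tree :: "('v, 'e) pre_digraph \<Rightarrow> 'v \<Rightarrow> bool" where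
  "rooted_tree T r0 \<longleftrightarrow>
     sym_digraph T \<and> loopfree_digraph T \<and> nomulti_digraph T \<and> r0 \<in> verts T \<and>
     (\<forall>u\<in>verts T. \<forall>v\<in>verts T. \<exists>!p. vpath p T \<and> hd p = u \<and> last p = v)"

text \<open>The parent of a non-root vertex is the second vertex on its path to the root.\<close>

definition parent :: "('v, 'e) pre_digraph \<Rightarrow> 'v \<Rightarrow> 'v \<Rightarrow> 'v" where
  "parent T r0 r = (THE p. vpath p T \<and> hd p = r \<and> last p = r0) ! 1"

definition children :: "('v, 'e) pre_digraph \<Rightarrow> 'v \<Rightarrow> 'v \<Rightarrow> 'v set" where
  "children T r0 r = {s \<in> verts T - {r0}. parent T r0 s = r}"


section \<open>Factorization trees\<close>

definition factorization_tree ::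
    "rat \<Rightarrow> ('v, 'e) pre_digraph \<Rightarrow> 'v \<Rightarrow> ('v \<Rightarrow> fact_seq) \<Rightarrow> bool" where
  "factorization_tree \<alpha> T r0 \<nu> \<longleftrightarrow>
     rooted_tree T r0 \<and>
     \<nu> ` verts T \<subseteq> all_facts \<alpha> \<and>
     \<nu> r0 = one_seq \<and>
     (\<forall>r\<in>verts T. \<forall>n<num_primes \<alpha>. factorization (partial \<alpha> n) (\<nu> r) \<longrightarrow> children T r0 r \<noteq> {}) \<and>
     (\<forall>r\<in>verts T - {r0}. \<forall>s\<in>verts T - {r0}.
        \<nu> r = \<nu> s \<and> parent T r0 r = parent T r0 s \<longrightarrow> r = s) \<and>
     (\<forall>r\<in>verts T - {r0}. direct_subfactorization \<alpha> (\<nu> (parent T r0 r)) (\<nu> r))"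

definition primitive_factorization_tree ::
    "rat \<Rightarrow> ('v, 'e) pre_digraph \<Rightarrow> 'v \<Rightarrow> ('v \<Rightarrow> fact_seq) \<Rightarrow> bool" where
  "primitive_factorization_tree \<alpha> T r0 \<nu> \<longleftrightarrow>
     factorization_tree \<alpha> T r0 \<nu> \<and> \<nu> ` verts T \<subseteq> primitive_facts \<alpha>"

definition optimal_factorization_tree ::
    "rat \<Rightarrow> ('v, 'e) pre_digraph \<Rightarrow> 'v \<Rightarrow> ('v \<Rightarrow> fact_seq) \<Rightarrow> bool" where
  "optimal_factorization_tree \<alpha> T r0 \<nu> \<longleftrightarrow>
     factorization_tree \<alpha> T r0 \<nu> \<and> optimal_facts \<alpha> \<subseteq> \<nu> ` verts T"

text \<open>
  For a factorization the entries different from \<open>1\<close> form an initial segment; \<open>fact_length\<close> is its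
  length \<open>\<ell>\<close>, which is also the 0-based position of the first entry equal to \<open>1\<close>.
\<close>

definition fact_length :: "fact_seq \<Rightarrow> nat" where
  "fact_length A = (LEAST l. \<forall>i\<ge>l. A i = (1, 1))"

definition delta :: "rat \<Rightarrow> nat \<Rightarrow> fact_seq \<Rightarrow> fact_seq set" where
  "delta \<alpha> n A = (let p = primes_of \<alpha> ! n in
     if p dvd num \<alpha>
     then {A(k := (nm A k * p, dn A k)) | k. nm A k * p < dn A k}
     else {A(k := (nm A k, dn A k * p)) | k. dn A k * p < nm A k})"

definition epsilon :: "rat \<Rightarrow> nat \<Rightarrow> fact_seq \<Rightarrow> fact_seq set" where
  "epsilon \<alpha> n A = (let p = primes_of \<alpha> ! n in
     if p dvd num \<alpha>
     then {A(fact_length A := (p, 1))}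
     else {A(fact_length A := (1, p))})"

text \<open>
  The \<open>n\<close> with \<open>\<nu> r\<close> a factorization of \<open>partial \<alpha> n\<close> is determined by \<open>\<nu> r\<close>, since the numbers
  \<open>partial \<alpha> n\<close> for \<open>n \<le> num_primes \<alpha>\<close> are distinct; for a non-leaf it satisfies \<open>n < num_primes \<alpha>\<close>.
\<close>

definition canonical_optimal_factorization_tree ::
    "rat \<Rightarrow> ('v, 'e) pre_digraph \<Rightarrow> 'v \<Rightarrow> ('v \<Rightarrow> fact_seq) \<Rightarrow> bool" where
  "canonical_optimal_factorization_tree \<alpha> T r0 \<nu> \<longleftrightarrow>
     factorization_tree \<alpha> T r0 \<nu> \<and>
     (\<forall>r\<in>verts T. children T r0 r \<noteq> {} \<longrightarrow>
        (\<forall>n<num_primes \<alpha>. factorization (partial \<alpha> n) (\<nu> r) \<longrightarrow>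
           \<nu> ` children T r0 r =
             (if delta \<alpha> n (\<nu> r) \<noteq> {} then delta \<alpha> n (\<nu> r) else epsilon \<alpha> n (\<nu> r))))"

end

theory Submission
  imports Defs "HOL-Library.Multiset_Order"
begin

text \<open>
  Attach to a factorization the multiset of its numbers \<open>max a\<^sub>i b\<^sub>i\<close>. For large \<open>t\<close> the power
  sums of the logarithms compare like these multisets in the multiset order, so an optimal
  factorization of \<open>\<alpha>\<^sub>n\<close> has the least multiset among all decompositions of \<open>\<alpha>\<^sub>n\<close> into rationals
  without cancellation. For this, only the trivial bound of the infimum \<open>m\<^sub>t\<close> by one of its members
  is needed.

  Minimality descends along the primes. A minimal factorization is primitive, as a composite
  maximum could be split. If the least prime \<open>p = p\<^sub>n\<^sub>+\<^sub>1\<close> occurs as an entry of its own, removing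
  the last such entry leaves a minimal factorization of \<open>\<alpha>\<^sub>n\<close> into which \<open>p\<close> cannot be absorbed;
  otherwise \<open>p\<close> divides the smaller side of some entry and can be cancelled there without changing
  any maximum. These are the two growth rules of the canonical tree, so every minimal factorization
  occurs in it. Both rules preserve primitivity.
\<close>

section \<open>Mahler measure of rational numbers\<close>

text \<open>Degree one forces one factor to be constant. A constant factor divides both
  coefficients, hence is a unit by coprimality.\<close>

lemma irreducible_linear_int_poly:
  fixes a b :: int
  assumes "b \<noteq> 0" "Rings.coprime a b"
  shows "irreducible [:- a, b:]"
proof (rule irreducibleI)
  have unit: "is_unit w" if eq: "[:- a, b:] = w * x" and deg: "degree w = 0" for w x
  proof -
    obtain e where e: "w = [:e:]" using deg by (auto elim: degree_eq_zeroE)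
    have eq': "[:- a, b:] = Polynomial.smult e x" using eq by (simp add: e)
    have "- a = e * poly.coeff x 0" "b = e * poly.coeff x 1"
      using arg_cong[OF eq', of "\<lambda>p. poly.coeff p 0"] arg_cong[OF eq', of "\<lambda>p. poly.coeff p 1"]
      by simp_all
    then have "e dvd a" "e dvd b" by (metis dvd_minus_iff dvd_triv_left)+
    then have "is_unit e" using assms(2) coprime_common_divisor by blast
    then show ?thesis by (simp add: e is_unit_const_poly_iff)
  qed
  fix u v assume uv: "[:- a, b:] = u * v"
  then have "u \<noteq> 0" "v \<noteq> 0" using assms(1) by auto
  then have "degree u + degree v = 1"
    using degree_mult_eq[of u v] uv[symmetric] assms(1) by simp
  then show "is_unit u \<or> is_unit v"
    using uv unit[of u v] unit[of v u] by (auto simp: add_is_1 mult.commute)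
qed (use assms(1) in \<open>auto simp: is_unit_poly_iff\<close>)

text \<open>The leading coefficient \<open>b\<close> need not be a unit, so pseudo-division is used.
  Its constant remainder vanishes at the root and is therefore zero. The extra factor
  \<open>b ^ k\<close> is then dropped, because the linear polynomial is a prime element and divides
  no nonzero constant.\<close>

lemma poly_of_int_linear_root_imp_dvd:
  fixes a b :: int and f :: "int poly"
  assumes "b \<noteq> 0" "Rings.coprime a b"
    and root: "poly (map_poly of_int f) (of_int a / of_int b :: complex) = 0"
  shows "[:- a, b:] dvd f"
proof -
  let ?q = "[:- a, b:]"
  obtain g r where gr: "pseudo_divmod f ?q = (g, r)" by force
  obtain k where k: "Polynomial.smult (b ^ k) f = ?q * g + r" and r: "r = 0 \<or> degree r < degree ?q"
    using pseudo_divmod[OF _ gr] assms(1) by auto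
  obtain c where c: "r = [:c:]" using r assms(1) by (cases r) (auto split: if_splits)
  have h: "poly (map_poly of_int (p * q)) (z::complex) = poly (map_poly of_int p) z * poly (map_poly of_int q) z"
    "poly (map_poly of_int (p + q)) z = poly (map_poly of_int p) z + poly (map_poly of_int q) z"
    for p q :: "int poly" and z
    by (simp_all add: of_int_poly_hom.hom_mult of_int_poly_hom.hom_add)
  have "poly (map_poly of_int (Polynomial.smult (b ^ k) f)) (of_int a / of_int b :: complex) = 0"
    using root h(1)[of "[:b^k:]" f] by simp
  then have "r = 0"
    unfolding k h using assms(1) by (simp add: c of_int_hom.map_poly_pCons_hom)
  then have "?q dvd Polynomial.smult (b ^ k) f" using k by (metis add.right_neutral dvd_triv_left)
  then have d: "?q dvd [:b ^ k:] * f" by simp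
  have prime: "prime_elem ?q"
    using irreducible_linear_int_poly[OF assms(1,2)] by (rule irreducible_imp_prime_elem)
  have "?q dvd [:b ^ k:] \<or> ?q dvd f" using d by (rule prime_elem_dvd_multD[OF prime])
  moreover have "\<not> ?q dvd [:b ^ k:]"
    using dvd_imp_degree_le[of ?q "[:b ^ k:]"] assms(1) by auto
  ultimately show ?thesis by blast
qed

text \<open>An irreducible multiple of the linear polynomial differs from it by a unit, that is by a
  sign, and the positive leading coefficient fixes the sign.\<close>

lemma int_min_poly_rational:
  fixes a b :: int
  assumes "b > 0" "Rings.coprime a b"
  shows "int_min_poly (of_int a / of_int b) = [:- a, b:]"
  unfolding int_min_poly_def
proof (rule the_equality)
  have irr: "irreducible [:- a, b:]" using irreducible_linear_int_poly assms by simp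
  then show "irreducible [:- a, b:] \<and> lead_coeff [:- a, b:] > 0 \<and>
      poly (map_poly of_int [:- a, b:]) (of_int a / of_int b :: complex) = 0"
    using assms(1) by (simp add: of_int_hom.map_poly_pCons_hom)
  fix f :: "int poly"
  assume f: "irreducible f \<and> lead_coeff f > 0 \<and> poly (map_poly of_int f) (of_int a / of_int b :: complex) = 0"
  then obtain h where h: "f = [:- a, b:] * h"
    using poly_of_int_linear_root_imp_dvd[of b a f] assms by (auto elim!: dvdE)
  then have "is_unit h"
    using f irr irreducibleD[of f "[:- a, b:]" h] unfolding irreducible_def by blast
  then obtain u where u: "h = [:u:]" "is_unit u" by (auto simp: is_unit_poly_iff)
  then have "u = 1 \<or> u = -1" by (simp add: zdvd1_eq) (auto simp: abs_if split: if_splits)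
  moreover have "lead_coeff f = b * u" using assms(1) u unfolding h by (auto simp: lead_coeff_mult)
  ultimately show "f = [:- a, b:]" using f assms(1) u h by (auto simp: mult_neg_pos)
qed

text \<open>The only root is a/b, so the measure is |b| times max(1, |a/b|).\<close>

lemma mahler_measure_linear:
  fixes a b :: int
  assumes "b \<noteq> 0"
  shows "mahler_measure [:- a, b:] = max \<bar>a\<bar> \<bar>b\<bar>"
proof -
  have "map_poly complex_of_int [:- a, b:] = Polynomial.smult (of_int b) (\<Prod>x\<leftarrow>[of_int a / of_int b]. [:- x, 1:])"
    using assms by (simp add: of_int_hom.map_poly_pCons_hom)
  then have "mahler_measure [:- a, b:] = \<bar>of_int b\<bar> * max 1 (\<bar>of_int a\<bar> / \<bar>of_int b\<bar>)"
    unfolding mahler_measure_def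
    using mahler_measure_poly_explicit[of "of_int b" "[of_int a / of_int b]"]
    by (simp add: norm_divide)
  also have "\<dots> = max \<bar>of_int a\<bar> \<bar>of_int b\<bar>"
    using assms by (auto simp: max_def field_simps)
  finally show ?thesis by simp
qed

lemma log_mahler_rational:
  fixes c d :: nat
  assumes "d > 0" "Rings.coprime c d"
  shows "log_mahler (of_nat c / of_nat d) = ln (real (max c d))"
  using int_min_poly_rational[of "int d" "int c"] mahler_measure_linear[of "int d" "int c"] assms
  by (simp add: log_mahler_def of_nat_max)

lemma algebraic_of_nat_div: "algebraic (of_nat c / of_nat d)"
  by (intro rat_imp_algebraic) auto

section \<open>Decompositions with minimal heights\<close>

definition heights :: "(nat \<times> nat) multiset \<Rightarrow> nat multiset" where
  "heights R = image_mset (\<lambda>(c, d). max c d) R"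

text \<open>Both products are prescribed exactly, so nothing may cancel between entries. Leaving out
  (1, 1) makes every height exceed 1 when \<open>P\<close> and \<open>Q\<close> are positive, so
  that its logarithm is positive.\<close>

definition admissible :: "nat \<Rightarrow> nat \<Rightarrow> (nat \<times> nat) multiset \<Rightarrow> bool" where
  "admissible P Q R \<longleftrightarrow>
     (1, 1) \<notin># R \<and> prod_mset (image_mset fst R) = P \<and> prod_mset (image_mset snd R) = Q"

text \<open>The multiset order over \<open>nat\<close> is total, so this asks for a least element
  and not merely a minimal one.\<close>

definition height_minimal :: "nat \<Rightarrow> nat \<Rightarrow> (nat \<times> nat) multiset \<Rightarrow> bool" where
  "height_minimal P Q R \<longleftrightarrow>
     admissible P Q R \<and> (\<forall>S. admissible P Q S \<longrightarrow> heights R \<le> heights S)"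

lemma heights_simps [simp]:
  "heights {#} = {#}"
  "heights (add_mset x R) = add_mset (max (fst x) (snd x)) (heights R)"
  "heights (R + S) = heights R + heights S"
  by (simp_all add: heights_def case_prod_beta)

text \<open>The Dershowitz-Manna form of the order: a smaller multiset arises by replacing a
  nonempty part \<open>J\<close> by a part \<open>K\<close> dominated by it. The next lemma is the
  converse.\<close>

lemma multiset_less_decompose:
  fixes M N :: "'a :: preorder multiset"
  assumes "M < N"
  obtains I J K where "N = I + J" "M = I + K" "J \<noteq> {#}" "\<And>k. k \<in># K \<Longrightarrow> \<exists>j\<in>#J. k < j"
  using assms multp_implies_one_step[of "(<)" M N] unfolding less_multiset_def by auto

lemma multiset_less_union:
  fixes I J K :: "'a :: preorder multiset"
  assumes "J \<noteq> {#}" "\<And>k. k \<in># K \<Longrightarrow> \<exists>j\<in>#J. k < j"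
  shows "I + K < I + J"
  using assms one_step_implies_multp[of J K "(<)" I] unfolding less_multiset_def by blast

lemma admissible_dvd:
  assumes "admissible P Q R" "(c, d) \<in># R"
  shows "c dvd P" "d dvd Q"
proof -
  have "c \<in># image_mset fst R" "d \<in># image_mset snd R" using assms(2) by force+
  then show "c dvd P" "d dvd Q" using assms(1) by (auto simp only: admissible_def dvd_prod_mset)
qed

lemma admissible_add_mset:
  "admissible P Q (add_mset (c, d) R) \<longleftrightarrow> (c, d) \<noteq> (1, 1) \<and>
     (1, 1) \<notin># R \<and> c * prod_mset (image_mset fst R) = P \<and> d * prod_mset (image_mset snd R) = Q"
  by (auto simp: admissible_def)

text \<open>If c = q * e were composite, the entry could be split into (q, 1) and (e, d). Both new
  heights lie below c, so the multiset would drop.\<close>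

lemma height_minimal_prime_aux:
  assumes min: "height_minimal P Q R" and "(c, d) \<in># R" and pos: "P > 0" "Q > 0" and "d < c"
  shows "prime c"
proof (rule ccontr)
  assume np: "\<not> prime c"
  obtain R' where R': "R = add_mset (c, d) R'" using assms(2) by (metis multi_member_split)
  have adm: "admissible P Q R" using min by (simp add: height_minimal_def)
  have "d > 0" using admissible_dvd(2)[OF adm assms(2)] pos by (auto intro: Nat.gr0I)
  with \<open>d < c\<close> have "c \<noteq> 1" by simp
  then obtain q e where q: "prime q" and e: "c = q * e"
    by (metis prime_factor_nat dvdE)
  have "e \<noteq> 1" "e > 0" using np q e \<open>d < c\<close> by (auto intro: Nat.gr0I)
  then have lt: "q < c" "e < c" using prime_gt_1_nat[OF q] e by auto
  let ?S = "add_mset (q, 1) (add_mset (e, d) R')"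
  have "admissible P Q ?S"
    using adm q \<open>e \<noteq> 1\<close> prime_gt_1_nat[OF q] unfolding R' by (auto simp: admissible_def e ac_simps)
  then have "heights R \<le> heights ?S" using min unfolding height_minimal_def by blast
  moreover have "heights R' + {#q, max e d#} < heights R' + {#c#}"
    using lt \<open>d < c\<close> by (intro multiset_less_union) auto
  moreover have "heights R = heights R' + {#c#}" using \<open>d < c\<close> by (simp add: R')
  moreover have "heights ?S = heights R' + {#q, max e d#}"
    using prime_gt_1_nat[OF q] by (simp add: add_mset_commute)
  ultimately show False by (metis leD)
qed

section \<open>Symmetry between numerators and denominators\<close>

lemma image_fst_swap: "image_mset fst (image_mset prod.swap R) = image_mset snd R"
  "image_mset snd (image_mset prod.swap R) = image_mset fst R"
  by (simp_all add: multiset.map_comp comp_def)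

lemma admissible_swap [simp]: "admissible Q P (image_mset prod.swap R) \<longleftrightarrow> admissible P Q R"
  unfolding admissible_def image_fst_swap by force

lemma heights_swap [simp]: "heights (image_mset prod.swap R) = heights R"
  by (simp add: heights_def multiset.map_comp comp_def case_prod_unfold max.commute)

lemma height_minimal_swap [simp]:
  "height_minimal Q P (image_mset prod.swap R) \<longleftrightarrow> height_minimal P Q R"
proof -
  have "(\<forall>S. admissible Q P S \<longrightarrow> heights R \<le> heights S) \<longleftrightarrow>
        (\<forall>S. admissible P Q S \<longrightarrow> heights R \<le> heights S)"
    by (metis admissible_swap heights_swap)
  then show ?thesis by (simp add: height_minimal_def)
qed

text \<open>Coprimality and the exclusion of (1, 1) make the two sides of an entry different. The
  case of a larger denominator follows by swapping.\<close>

lemma height_minimal_prime: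
  assumes min: "height_minimal P Q R" and in_R: "(c, d) \<in># R"
    and PQ: "Rings.coprime P Q" "P > 0" "Q > 0"
  shows "prime (max c d)"
proof -
  have adm: "admissible P Q R" using min by (simp add: height_minimal_def)
  have "Rings.coprime c d" using admissible_dvd[OF adm in_R] PQ(1) by (meson coprime_divisors)
  moreover have "(c, d) \<noteq> (1, 1)" using adm in_R by (auto simp: admissible_def)
  ultimately have "c \<noteq> d" by auto
  then consider "d < c" | "c < d" by linarith
  then show ?thesis
  proof cases
    case 1
    then show ?thesis using height_minimal_prime_aux[OF min in_R] PQ by simp
  next
    case 2
    have "(d, c) \<in># image_mset prod.swap R" using in_R by force
    with 2 show ?thesis
    using height_minimal_prime_aux[of Q P "image_mset prod.swap R" d c] min PQ by simp
  qed
qed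

text \<open>Heights are primes dividing \<open>P * Q\<close>, so none is below the least prime
  \<open>p\<close>. If the height is \<open>p\<close>, it is attained by the numerator, as
  \<open>p\<close> does not divide \<open>Q\<close>; a prime factor of the denominator would then be
  smaller than \<open>p\<close>.\<close>

lemma height_minimal_single:
  assumes min: "height_minimal P Q R" and in_R: "(c, d) \<in># R"
    and PQ: "Rings.coprime P Q" "P > 0" "Q > 0"
    and p: "prime p" "p dvd P" and small: "\<And>q. prime q \<Longrightarrow> q dvd P * Q \<Longrightarrow> p \<le> q"
  shows "p \<le> max c d" and "max c d = p \<Longrightarrow> (c, d) = (p, 1)"
proof -
  have adm: "admissible P Q R" using min by (simp add: height_minimal_def)
  have dv: "c dvd P" "d dvd Q" using admissible_dvd[OF adm in_R] by auto
  have "max c d dvd P * Q" using dv by (auto simp: max_def)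
  then show "p \<le> max c d" using height_minimal_prime[OF min in_R PQ] small by blast
  assume eq: "max c d = p"
  have "\<not> p dvd Q" using p PQ(1) by (meson coprime_common_divisor not_prime_unit)
  then have "d \<noteq> p" using dv by auto
  then have "c = p" "d < p" using eq by (auto simp: max_def split: if_splits)
  moreover have "d = 1"
  proof (rule ccontr)
    assume "d \<noteq> 1"
    then obtain q where q: "prime q" "q dvd d" using prime_factor_nat by blast
    then have "p \<le> q" using small dv by (meson dvd_mult dvd_trans)
    moreover have "q \<le> d" using q dv PQ(3) by (meson dvd_imp_le dvd_pos_nat)
    ultimately show False using \<open>d < p\<close> by simp
  qed
  ultimately show "(c, d) = (p, 1)" by simp
qed

text \<open>Adjoining (p, 1) to a competitor adds the same height to both sides of the comparison,
  and it cancels. If \<open>p\<close> could be absorbed by an entry (c, d) with c * p < d, that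
  would leave its height d unchanged and save the height \<open>p\<close> altogether.\<close>

lemma height_minimal_remove_single:
  assumes min: "height_minimal (P * p) Q (add_mset (p, 1) R)" and p: "prime p"
  shows "height_minimal P Q R" and "(c, d) \<in># R \<Longrightarrow> \<not> c * p < d"
proof -
  have adm: "admissible P Q R"
    using min p prime_gt_0_nat[OF p]
    by (auto simp: height_minimal_def admissible_add_mset) (auto simp: admissible_def)
  show "height_minimal P Q R"
    unfolding height_minimal_def
  proof (intro conjI allI impI adm)
    fix S assume "admissible P Q S"
    then have "admissible (P * p) Q (add_mset (p, 1) S)"
      using prime_gt_1_nat[OF p] by (simp add: admissible_def)
    then have "heights (add_mset (p, 1) R) \<le> heights (add_mset (p, 1) S)"
      using min unfolding height_minimal_def by blast
    then show "heights R \<le> heights S" by simp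
  qed
  assume "(c, d) \<in># R"
  then obtain R' where R': "R = add_mset (c, d) R'" by (metis multi_member_split)
  show "\<not> c * p < d"
  proof
    assume lt: "c * p < d"
    have "c < d"
      using lt prime_gt_0_nat[OF p] by (metis le_less_trans mult_le_mono2 nat_mult_1_right Suc_leI One_nat_def)
    let ?S = "add_mset (c * p, d) R'"
    have "admissible (P * p) Q ?S"
      using adm prime_gt_1_nat[OF p] unfolding R' by (auto simp: admissible_def ac_simps)
    then have "heights (add_mset (p, 1) R) \<le> heights ?S"
      using min unfolding height_minimal_def by blast
    moreover have "heights ?S = heights R" using lt \<open>c < d\<close> by (simp add: R')
    moreover have "heights R + {#} < heights R + {#p#}" by (intro multiset_less_union) auto
    ultimately show False using prime_gt_1_nat[OF p] by simp
  qed
qed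

text \<open>
  If some height were equal to \<open>p\<close>, a competitor lacking exactly that height would become equal, not
  smaller, after adjoining \<open>p\<close>; hence the assumption that all heights exceed \<open>p\<close>.
\<close>

lemma height_minimal_divide:
  assumes min: "height_minimal (P * p) Q (add_mset (c * p, d) R)" and p: "prime p" and lt: "c * p < d"
    and big: "\<And>x. x \<in># heights (add_mset (c * p, d) R) \<Longrightarrow> p < x"
  shows "height_minimal P Q (add_mset (c, d) R)"
  unfolding height_minimal_def
proof (intro conjI allI impI)
  have "(c, d) \<noteq> (1, 1)" using lt prime_gt_0_nat[OF p] by auto
  then show "admissible P Q (add_mset (c, d) R)"
    using min prime_gt_0_nat[OF p] by (auto simp: height_minimal_def admissible_def ac_simps)
  fix S assume S: "admissible P Q S"
  then have "admissible (P * p) Q (add_mset (p, 1) S)"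
    using prime_gt_1_nat[OF p] by (simp add: admissible_def)
  then have le: "heights (add_mset (c * p, d) R) \<le> heights (add_mset (p, 1) S)"
    using min unfolding height_minimal_def by blast
  have "c < d"
    using lt prime_gt_0_nat[OF p] by (metis le_less_trans mult_le_mono2 nat_mult_1_right Suc_leI One_nat_def)
  have same: "heights (add_mset (c, d) R) = heights (add_mset (c * p, d) R)"
    using lt \<open>c < d\<close> by simp
  show "heights (add_mset (c, d) R) \<le> heights S"
  proof (rule ccontr)
    assume "\<not> ?thesis"
    then have "heights S < heights (add_mset (c * p, d) R)" unfolding same by simp
    then obtain I J K where IJK: "heights (add_mset (c * p, d) R) = I + J" "heights S = I + K" "J \<noteq> {#}"
      and K: "\<And>k. k \<in># K \<Longrightarrow> \<exists>j\<in>#J. k < j"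
      by (rule multiset_less_decompose) blast
    \<comment> \<open>Every element of \<open>J\<close> is a height of the given decomposition and
      so exceeds \<open>p\<close>. Hence \<open>p\<close> may join \<open>K\<close>, and the
      competitor with (p, 1) adjoined is still strictly smaller.\<close>
    have "\<exists>j\<in>#J. p < j"
    proof -
      obtain j where "j \<in># J" using IJK(3) by blast
      then show ?thesis using big unfolding IJK(1) by auto
    qed
    then have "I + add_mset p K < I + J"
      using IJK(3) K by (intro multiset_less_union) auto
    then show False using le IJK prime_gt_1_nat[OF p] by simp
  qed
qed

section \<open>Comparison of power sums\<close>

lemma sum_mset_nonneg:
  fixes f :: "'a \<Rightarrow> real"
  assumes "\<And>x. 0 \<le> f x"
  shows "0 \<le> (\<Sum>x\<in>#M. f x)"
  using assms by (induction M) auto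

text \<open>By totality, failure means \<open>N < M\<close>. After removing the common part, the
  largest base decides for large \<open>t\<close>, and it belongs to \<open>M\<close>.\<close>

lemma powr_sum_dominated_imp_le:
  fixes M N :: "nat multiset"
  assumes M: "\<And>x. x \<in># M \<Longrightarrow> 1 < x" and N: "\<And>x. x \<in># N \<Longrightarrow> 1 < x"
    and dom: "\<And>t. t \<ge> T \<Longrightarrow> (\<Sum>x\<in>#M. ln (real x) powr t) \<le> (\<Sum>x\<in>#N. ln (real x) powr t)"
  shows "M \<le> N"
proof (rule ccontr)
  assume "\<not> M \<le> N"
  then have "N < M" by simp
  then obtain I J K where IJK: "M = I + J" "N = I + K" "J \<noteq> {#}"
    and K: "\<And>k. k \<in># K \<Longrightarrow> \<exists>j\<in>#J. k < j"
    by (rule multiset_less_decompose) blast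
  \<comment> \<open>The maximum of \<open>J\<close> exceeds all elements of \<open>K\<close> at
    once.\<close>
  define y where "y = Max_mset J"
  have y: "y \<in># J" using IJK(3) by (simp add: y_def)
  have Ky: "k < y" if k: "k \<in># K" for k
  proof -
    obtain j where "j \<in># J" "k < j" using K[OF k] by blast
    then show ?thesis using Max_ge[of "set_mset J" j] unfolding y_def by (auto intro: less_le_trans)
  qed
  have "1 < y" using M y IJK(1) by simp
  have lny: "0 < ln (real y)" using \<open>1 < y\<close> by simp
  \<comment> \<open>After division by \<open>ln y\<close> all bases lie strictly between 0 and 1, so
    each of the finitely many powers decays.\<close>
  have "((\<lambda>t. \<Sum>x\<in>#K. (ln (real x) / ln (real y)) powr t) \<longlongrightarrow> 0) at_top"
    using N Ky unfolding IJK(2)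
  proof (induction K)
    case (add x K)
    have "1 < x" "x < y" using add.prems by auto
    have lim: "((\<lambda>t. (ln (real x) / ln (real y)) powr t) \<longlongrightarrow> 0) at_top"
    proof -
      define r where "r = ln (real x) / ln (real y)"
      have "0 < r" "r < 1" using \<open>1 < x\<close> \<open>x < y\<close> by (auto simp: r_def)
      then have "ln r < 0" by simp
      then have "((\<lambda>t. exp (t * ln r)) \<longlongrightarrow> 0) at_top" by real_asymp
      then show ?thesis unfolding r_def[symmetric] using \<open>0 < r\<close> by (simp add: powr_def)
    qed
    from tendsto_add[OF lim add.IH] add.prems show ?case by auto
  qed simp
  then have "eventually (\<lambda>t. (\<Sum>x\<in>#K. (ln (real x) / ln (real y)) powr t) < 1) at_top"
    by (rule order_tendstoD) simp
  then have "eventually (\<lambda>t. t \<ge> T \<and> (\<Sum>x\<in>#K. (ln (real x) / ln (real y)) powr t) < 1) at_top"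
    by (intro eventually_conj eventually_ge_at_top)
  from eventually_happens[OF this] obtain t where
    t: "t \<ge> T" "(\<Sum>x\<in>#K. (ln (real x) / ln (real y)) powr t) < 1"
    by auto
  have "(\<Sum>x\<in>#K. (ln (real x) / ln (real y)) powr t) * ln (real y) powr t = (\<Sum>x\<in>#K. ln (real x) powr t)"
    using N unfolding IJK(2)
  proof (induction K)
    case (add x K)
    then have "1 < x" by auto
    with add lny show ?case by (auto simp: powr_divide distrib_right)
  qed simp
  moreover have "(\<Sum>x\<in>#K. (ln (real x) / ln (real y)) powr t) * ln (real y) powr t < 1 * ln (real y) powr t"
    using t(2) lny by (intro mult_strict_right_mono) auto
  ultimately have "(\<Sum>x\<in>#K. ln (real x) powr t) < ln (real y) powr t" by simp
  also have "\<dots> \<le> (\<Sum>x\<in>#J. ln (real x) powr t)"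
  proof -
    obtain J' where "J = add_mset y J'" using y by (metis multi_member_split)
    moreover have "0 \<le> (\<Sum>x\<in>#J'. ln (real x) powr t)" by (rule sum_mset_nonneg) simp
    ultimately show ?thesis by simp
  qed
  finally show False using dom[OF t(1)] unfolding IJK by simp
qed

text \<open>Listing \<open>S\<close> in some order gives one of the products over which the infimum
  is taken. The set of values is bounded below by 0.\<close>

lemma metric_mahler_le:
  assumes adm: "admissible P Q S" and PQ: "Rings.coprime P Q" "P > 0" "Q > 0"
  shows "metric_mahler t (of_nat P / of_nat Q) \<le> (\<Sum>x\<in>#heights S. ln (real x) powr t) powr (1 / t)"
proof -
  obtain xs where xs: "mset xs = S" by (metis ex_mset)
  define f :: "nat \<times> nat \<Rightarrow> complex" where "f = (\<lambda>x. of_nat (fst x) / of_nat (snd x))"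
  define x where "x = (\<lambda>n. f (xs ! n))"
  have in_S: "fst y > 0" "snd y > 0" "Rings.coprime (fst y) (snd y)" if "y \<in># S" for y
    using admissible_dvd[OF adm, of "fst y" "snd y"] that PQ
    by (auto intro: Nat.gr0I coprime_divisors)
  have prod: "prod_mset (image_mset f U) =
      of_nat (prod_mset (image_mset fst U)) / of_nat (prod_mset (image_mset snd U))" for U
    by (induction U) (auto simp: f_def)
  have "of_nat P / of_nat Q = prod_mset (image_mset f S)"
    using adm unfolding prod admissible_def by simp
  also have "\<dots> = (\<Prod>n<length xs. x n)"
    unfolding xs[symmetric] x_def
    by (simp flip: mset_map add: prod_mset_prod_list prod.list_conv_set_nth atLeast0LessThan)
  finally have 1: "of_nat P / of_nat Q = (\<Prod>n<length xs. x n)" .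
  have nth_S: "xs ! n \<in># S" if "n < length xs" for n using that xs by auto
  have 2: "algebraic (x n)" "x n \<noteq> 0" if "n < length xs" for n
    using in_S[OF nth_S[OF that]] by (simp_all add: x_def f_def algebraic_of_nat_div)
  have "(\<Sum>n<length xs. log_mahler (x n) powr t) = (\<Sum>y\<in>#S. log_mahler (f y) powr t)"
    unfolding xs[symmetric] x_def
    by (simp flip: mset_map add: sum_mset_sum_list sum.list_conv_set_nth atLeast0LessThan)
  also have "\<dots> = (\<Sum>y\<in>#S. ln (real (max (fst y) (snd y))) powr t)"
    using in_S
    by (intro arg_cong[of _ _ sum_mset] image_mset_cong) (simp add: f_def log_mahler_rational)
  also have "\<dots> = (\<Sum>x\<in>#heights S. ln (real x) powr t)"
    by (simp add: heights_def multiset.map_comp comp_def case_prod_beta)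
  finally have 3: "(\<Sum>n<length xs. log_mahler (x n) powr t) = (\<Sum>x\<in>#heights S. ln (real x) powr t)" .
  show ?thesis
    unfolding metric_mahler_def 3[symmetric] using 1 2
    by (intro cInf_lower bdd_belowI[of _ 0]) auto
qed

section \<open>Factorizations as sequences\<close>

text \<open>For an infinite support \<open>mset_set\<close> yields the empty multiset, which is why
  finiteness is a separate condition in \<open>seq_fact\<close>.\<close>

definition entries :: "fact_seq \<Rightarrow> (nat \<times> nat) multiset" where
  "entries A = image_mset A (mset_set (supp A))"

text \<open>An integer version of \<open>factorization\<close>: the exact products replace both the
  value of the quotient and the coprimality conditions, given that \<open>P\<close> and
  \<open>Q\<close> are coprime and positive.\<close>

definition seq_fact :: "nat \<Rightarrow> nat \<Rightarrow> fact_seq \<Rightarrow> bool" where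
  "seq_fact P Q A \<longleftrightarrow> finite (supp A) \<and> admissible P Q (entries A) \<and>
     (\<forall>i. max (nm A (Suc i)) (dn A (Suc i)) \<le> max (nm A i) (dn A i))"

lemma prod_entries:
  "prod_mset (image_mset fst (entries A)) = (\<Prod>i\<in>supp A. nm A i)"
  "prod_mset (image_mset snd (entries A)) = (\<Prod>i\<in>supp A. dn A i)"
  by (simp_all add: entries_def multiset.map_comp comp_def prod_unfold_prod_mset)

lemma one_notin_entries: "(1, 1) \<notin># entries A"
  by (cases "finite (supp A)") (auto simp: entries_def supp_def)

lemma in_entries_iff: "finite (supp A) \<Longrightarrow> x \<in># entries A \<longleftrightarrow> x \<noteq> (1, 1) \<and> (\<exists>i. A i = x)"
  by (auto simp: entries_def supp_def)

lemma seq_fact_dvd: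
  assumes "seq_fact P Q A"
  shows "nm A i dvd P" "dn A i dvd Q"
proof -
  have "A i = (1, 1) \<or> (nm A i, dn A i) \<in># entries A"
    using assms in_entries_iff[of A "A i"] by (auto simp: seq_fact_def)
  then show "nm A i dvd P" "dn A i dvd Q"
    using assms admissible_dvd[of P Q "entries A" "nm A i" "dn A i"] by (auto simp: seq_fact_def)
qed

text \<open>Pairwise coprimality makes the two products coprime, and two equal reduced fractions
  have equal numerators and denominators. Conversely, the entries divide \<open>P\<close> and
  \<open>Q\<close> and inherit positivity and coprimality from them.\<close>

lemma factorization_iff_seq_fact:
  assumes "Rings.coprime P Q" "P > 0" "Q > 0"
  shows "factorization (of_nat P / of_nat Q) A \<longleftrightarrow> seq_fact P Q A"
proof
  assume A: "factorization (of_nat P / of_nat Q) A"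
  let ?X = "\<Prod>i\<in>supp A. nm A i" and ?Y = "\<Prod>i\<in>supp A. dn A i"
  have co: "Rings.coprime ?X ?Y"
    using A by (intro prod_coprime_left prod_coprime_right) (simp add: factorization_def)
  have "?Y > 0" using A by (intro prod_pos) (simp add: factorization_def)
  have "of_nat ?X / of_nat ?Y = (of_nat P / of_nat Q :: rat)"
    using A by (simp add: factorization_def prod_dividef)
  then have "(of_nat (?X * Q) :: rat) = of_nat (P * ?Y)"
    using \<open>?Y > 0\<close> assms(3) by (simp add: frac_eq_eq del: of_nat_prod)
  then have "?X * Q = P * ?Y" by (simp only: of_nat_eq_iff)
  then have "?X = P \<and> Q = ?Y"
    using coprime_crossproduct_nat[of ?X ?Y P Q] co assms(1) by (simp add: coprime_commute)
  then show "seq_fact P Q A"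
    using A one_notin_entries[of A]
    by (simp add: seq_fact_def factorization_def admissible_def prod_entries)
next
  assume A: "seq_fact P Q A"
  have "(\<Prod>i\<in>supp A. of_nat (nm A i) / of_nat (dn A i)) = (of_nat P / of_nat Q :: rat)"
    using A by (simp add: seq_fact_def admissible_def prod_entries prod_dividef flip: of_nat_prod)
  moreover have "nm A i > 0" "dn A i > 0" "Rings.coprime (nm A i) (dn A j)" for i j
    using seq_fact_dvd[OF A, of i] seq_fact_dvd[OF A, of j] assms
    by (auto intro: Nat.gr0I coprime_divisors)
  ultimately show "factorization (of_nat P / of_nat Q) A"
    using A by (simp add: factorization_def seq_fact_def)
qed

text \<open>Each competitor bounds the infimum from above, while \<open>A\<close> attains it for all
  large \<open>t\<close>. So the power sums of \<open>A\<close> are eventually dominated by those of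
  any competitor.\<close>

lemma optimal_imp_height_minimal:
  assumes PQ: "Rings.coprime P Q" "P > 0" "Q > 0"
    and opt: "optimal_factorization (of_nat P / of_nat Q) A"
  shows "height_minimal P Q (entries A)"
proof -
  have fact: "factorization (of_nat P / of_nat Q) A"
    using opt by (simp add: optimal_factorization_def)
  then have A: "seq_fact P Q A" using factorization_iff_seq_fact PQ by blast
  have gt1: "1 < x" if adm: "admissible P Q S" and x: "x \<in># heights S" for S x
  proof -
    obtain c d where cd: "(c, d) \<in># S" "x = max c d" using x by (auto simp: heights_def)
    then have "c > 0" "d > 0" using admissible_dvd[OF adm cd(1)] PQ by (auto intro: Nat.gr0I)
    moreover have "(c, d) \<noteq> (1, 1)" using adm cd(1) by (auto simp: admissible_def)
    ultimately show ?thesis unfolding cd(2) by auto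
  qed
  obtain T where T: "T > 0" and eq: "\<And>t. t \<ge> T \<Longrightarrow> metric_mahler t (of_rat (of_nat P / of_nat Q)) =
        (\<Sum>i\<in>supp A. log_mahler (of_nat (nm A i) / of_nat (dn A i)) powr t) powr (1 / t)"
    using opt by (auto simp: optimal_factorization_def)
  have sum_eq: "(\<Sum>i\<in>supp A. log_mahler (of_nat (nm A i) / of_nat (dn A i)) powr t) =
      (\<Sum>x\<in>#heights (entries A). ln (real x) powr t)" for t
  proof -
    have "(\<Sum>i\<in>supp A. log_mahler (of_nat (nm A i) / of_nat (dn A i)) powr t) =
        (\<Sum>i\<in>supp A. ln (real (max (nm A i) (dn A i))) powr t)"
      using fact by (intro sum.cong refl) (simp add: log_mahler_rational factorization_def)
    then show ?thesis
      by (simp add: heights_def entries_def multiset.map_comp comp_def case_prod_unfold sum_unfold_sum_mset)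
  qed
  show ?thesis unfolding height_minimal_def
  proof (intro conjI allI impI)
    show adm: "admissible P Q (entries A)" using A by (simp add: seq_fact_def)
    fix S assume S: "admissible P Q S"
    show "heights (entries A) \<le> heights S"
    proof (rule powr_sum_dominated_imp_le[where T = T])
      fix t assume t: "t \<ge> T"
      have "(\<Sum>x\<in>#heights (entries A). ln (real x) powr t) powr (1 / t) \<le> (\<Sum>x\<in>#heights S. ln (real x) powr t) powr (1 / t)"
        using metric_mahler_le[OF S PQ, of t] eq[OF t] unfolding sum_eq by (simp add: of_rat_divide)
      \<comment> \<open>As \<open>t \<ge> T > 0\<close>, the power 1/t is strictly increasing on
        nonnegative reals and can be removed.\<close>
      then show "(\<Sum>x\<in>#heights (entries A). ln (real x) powr t) \<le> (\<Sum>x\<in>#heights S. ln (real x) powr t)"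
        using t T powr_less_mono2[of "1 / t" "\<Sum>x\<in>#heights S. ln (real x) powr t" "\<Sum>x\<in>#heights (entries A). ln (real x) powr t"]
        by (force intro: sum_mset_nonneg simp: not_le)
    qed (use gt1 adm S in blast)+
  qed
qed

section \<open>Changing one entry of a sequence and swapping its sides\<close>

lemma entries_fun_upd_one:
  assumes "finite (supp A)" "A k = (1, 1)" "v \<noteq> (1, 1)"
  shows "entries (A(k := v)) = add_mset v (entries A)"
proof -
  have "supp (A(k := v)) = insert k (supp A)" "k \<notin> supp A" using assms by (auto simp: supp_def)
  moreover have "image_mset (A(k := v)) (mset_set (supp A)) = image_mset A (mset_set (supp A))"
    using \<open>k \<notin> supp A\<close> assms(1) by (intro image_mset_cong) auto
  ultimately show ?thesis using assms(1) by (simp add: entries_def)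
qed

lemma finite_supp_fun_upd [simp]: "finite (supp (A(k := v))) \<longleftrightarrow> finite (supp A)"
proof -
  have "supp (A(k := v)) \<subseteq> insert k (supp A)" "supp A \<subseteq> insert k (supp (A(k := v)))"
    by (auto simp: supp_def)
  then show ?thesis by (meson finite_insert finite_subset)
qed

lemma entries_split:
  assumes "finite (supp A)" "A k \<noteq> (1, 1)"
  shows "entries A = add_mset (A k) (entries (A(k := (1, 1))))"
  using entries_fun_upd_one[of "A(k := (1, 1))" k "A k"] assms by simp

lemma fact_length_eqI:
  assumes "\<And>i. i \<ge> k \<Longrightarrow> A i = (1, 1)" "\<And>i. i < k \<Longrightarrow> A i \<noteq> (1, 1)"
  shows "fact_length A = k"
  unfolding fact_length_def using assms
  by (intro Least_equality) (auto simp: not_le[symmetric])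

lemma supp_swap [simp]: "supp (prod.swap \<circ> A) = supp A"
  by (auto simp: supp_def prod_eq_iff)

lemma entries_swap [simp]: "entries (prod.swap \<circ> A) = image_mset prod.swap (entries A)"
  by (simp add: entries_def multiset.map_comp)

lemma seq_fact_swap [simp]: "seq_fact Q P (prod.swap \<circ> A) \<longleftrightarrow> seq_fact P Q A"
  by (simp add: seq_fact_def max.commute)

lemma fact_length_swap [simp]: "fact_length (prod.swap \<circ> A) = fact_length A"
proof -
  have "(prod.swap \<circ> A) i = (1, 1) \<longleftrightarrow> A i = (1, 1)" for i by (cases "A i") auto
  then show ?thesis by (simp only: fact_length_def)
qed

text \<open>This reverses one growth step for a prime of the numerator. The last alternative also
  records that no entry can absorb \<open>p\<close>, since only then does the canonical rule append
  a new entry.\<close>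

lemma height_minimal_predecessor:
  assumes C: "seq_fact (P * p) Q C" and min: "height_minimal (P * p) Q (entries C)"
    and PQ: "Rings.coprime (P * p) Q" "P > 0" "Q > 0" and p: "prime p"
    and small: "\<And>q. prime q \<Longrightarrow> q dvd P * p * Q \<Longrightarrow> p \<le> q"
  shows "\<exists>A. seq_fact P Q A \<and> height_minimal P Q (entries A) \<and>
    ((\<exists>k. nm A k * p < dn A k \<and> C = A(k := (nm A k * p, dn A k))) \<or>
     (\<forall>k. \<not> nm A k * p < dn A k) \<and> C = A(fact_length A := (p, 1)))"
proof -
  note p1 = prime_gt_1_nat[OF p]
  have pos: "P * p > 0" using PQ p1 by simp
  have fin: "finite (supp C)" and adm: "admissible (P * p) Q (entries C)"
    and dec: "\<And>i. max (nm C (Suc i)) (dn C (Suc i)) \<le> max (nm C i) (dn C i)"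
    using C by (auto simp: seq_fact_def)
  have antimono: "max (nm C j) (dn C j) \<le> max (nm C i) (dn C i)" if "i \<le> j" for i j
    using lift_Suc_antimono_le[of "\<lambda>i. max (nm C i) (dn C i)", OF dec that] .
  have single: "C i = (1, 1) \<or> p \<le> max (nm C i) (dn C i)"
    "max (nm C i) (dn C i) = p \<Longrightarrow> C i = (p, 1)" for i
  proof -
    have "C i = (1, 1) \<or> (nm C i, dn C i) \<in># entries C"
      using in_entries_iff[OF fin, of "C i"] by auto
    then show "C i = (1, 1) \<or> p \<le> max (nm C i) (dn C i)"
        "max (nm C i) (dn C i) = p \<Longrightarrow> C i = (p, 1)"
      using height_minimal_single[OF min _ PQ(1) pos PQ(3) p _ small, of "nm C i" "dn C i"] p1
      by auto
  qed
  show ?thesis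
  proof (cases "\<exists>i. C i = (p, 1)")
    case True
    have "{i. C i = (p, 1)} \<subseteq> supp C" using p1 by (auto simp: supp_def)
    then have fin': "finite {i. C i = (p, 1)}" using fin by (rule finite_subset)
    \<comment> \<open>Deleting the last copy of (p, 1) keeps the heights nonincreasing and leaves no
      gap.\<close>
    define k where "k = Max {i. C i = (p, 1)}"
    have k: "C k = (p, 1)" using Max_in[OF fin'] True by (auto simp: k_def)
    \<comment> \<open>A later nontrivial entry would have height at most \<open>p\<close> by
      monotonicity and at least \<open>p\<close> by minimality, so it would be a later copy of (p,
      1).\<close>
    have after: "C i = (1, 1)" if "i > k" for i
    proof (rule ccontr)
      assume "C i \<noteq> (1, 1)"
      then have "p \<le> max (nm C i) (dn C i)" using single(1) by blast
      moreover have "max (nm C i) (dn C i) \<le> p" using antimono[of k i] that k p1 by simp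
      ultimately have "C i = (p, 1)" using single(2) by simp
      then show False using Max_ge[OF fin', of i] that by (simp add: k_def)
    qed
    have before: "C i \<noteq> (1, 1)" if "i < k" for i
      using antimono[of i k] that k p1 by auto
    let ?A = "C(k := (1, 1))"
    have ent: "entries C = add_mset (p, 1) (entries ?A)"
      using entries_split[of C k] fin k p1 by simp
    \<comment> \<open>The removed position is exactly where the canonical rule appends, so appending
      restores \<open>C\<close>.\<close>
    have len: "fact_length ?A = k" using before after by (intro fact_length_eqI) auto
    note rem = height_minimal_remove_single[of P p Q "entries ?A", folded ent, OF min p]
    have "max (nm ?A (Suc i)) (dn ?A (Suc i)) \<le> max (nm ?A i) (dn ?A i)" for i
    proof -
      consider "Suc i = k" | "i = k" | "i \<noteq> k" "Suc i \<noteq> k" by blast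
      then show ?thesis
      proof cases
        case 1
        then have "1 \<le> max (nm C i) (dn C i)" using single(1)[of i] p1 by auto
        then show ?thesis using 1 by simp
      next
        case 2
        then show ?thesis using after[of "Suc k"] by simp
      next
        case 3
        then show ?thesis using dec[of i] by simp
      qed
    qed
    then have "seq_fact P Q ?A"
      using rem(1) fin unfolding seq_fact_def height_minimal_def by simp
    moreover have "\<not> nm ?A i * p < dn ?A i" for i
    proof (cases "?A i = (1, 1)")
      case True
      then show ?thesis using p1 by simp
    next
      case False
      moreover have "finite (supp ?A)" using fin by simp
      ultimately have "(nm ?A i, dn ?A i) \<in># entries ?A"
        unfolding prod.collapse using in_entries_iff[of ?A "?A i"] by blast
      then show ?thesis by (rule rem(2))
    qed
    moreover have "C = ?A(fact_length ?A := (p, 1))" unfolding len using k by auto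
    ultimately show ?thesis using rem(1) by (intro exI[of _ ?A] conjI disjI2 allI)
  next
    case False
    have big: "p < x" if x: "x \<in># heights (entries C)" for x
    proof -
      obtain c d where cd: "(c, d) \<in># entries C" "x = max c d" using x by (auto simp: heights_def)
      then obtain i where i: "C i = (c, d)" "C i \<noteq> (1, 1)"
        using in_entries_iff[OF fin, of "(c, d)"] by auto
      have "p \<le> x" using single(1)[of i] i(2) unfolding i(1) cd(2) by auto
      moreover have "x \<noteq> p" using single(2)[of i] i(1) cd(2) False by fastforce
      ultimately show ?thesis by simp
    qed
    \<comment> \<open>Some numerator must contain \<open>p\<close>; it remains to see that it is the
      smaller side of its entry.\<close>
    have "p dvd prod_mset (image_mset fst (entries C))" using adm by (simp add: admissible_def)
    then obtain x where x: "x \<in># entries C" "p dvd fst x"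
      using prime_dvd_prod_mset_iff[OF p] by auto
    from x(2) obtain c where "fst x = p * c" by (rule dvdE)
    then have "fst x = c * p" by (simp only: mult.commute)
    then obtain d where x_eq: "x = (c * p, d)" by (cases x) simp
    then obtain k where k: "C k = (c * p, d)" "C k \<noteq> (1, 1)"
      using x in_entries_iff[OF fin, of x] by auto
    have prime: "prime (max (c * p) d)"
      using height_minimal_prime[OF min _ PQ(1) pos PQ(3)] x x_eq by blast
    have gt: "p < max (c * p) d" using big x x_eq by (force simp: heights_def)
    \<comment> \<open>Otherwise the height would be \<open>c * p\<close>, a prime larger than its
      divisor \<open>p\<close>.\<close>
    have lt: "c * p < d"
    proof (rule ccontr)
      assume "\<not> c * p < d"
      then have "prime (c * p)" "p < c * p" using prime gt by (auto simp: max_def split: if_splits)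
      then show False using p1 prime_product[of c p] by auto
    qed
    let ?B = "C(k := (1, 1))" and ?A = "C(k := (c, d))"
    have ent: "entries C = add_mset (c * p, d) (entries ?B)"
      using entries_split[of C k] fin k by simp
    have "(c, d) \<noteq> (1, 1)" using lt p1 by auto
    then have ent': "entries ?A = add_mset (c, d) (entries ?B)"
      using entries_fun_upd_one[of ?B k "(c, d)"] fin by simp
    have minA: "height_minimal P Q (entries ?A)"
      unfolding ent'
      by (rule height_minimal_divide[OF min[unfolded ent] p lt big[unfolded ent]])
    have "c * 1 \<le> c * p" using p1 by (intro mult_le_mono) auto
    then have "c < d" using lt by linarith
    \<comment> \<open>The cancellation happens on the smaller side, so all heights and their order
      persist.\<close>
    then have same: "max (nm ?A i) (dn ?A i) = max (nm C i) (dn C i)" for i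
      using lt k by auto
    have "seq_fact P Q ?A"
      unfolding seq_fact_def same using minA fin dec by (simp add: height_minimal_def)
    moreover have "nm ?A k * p < dn ?A k" using lt by simp
    moreover have "C = ?A(k := (nm ?A k * p, dn ?A k))" using k by auto
    ultimately show ?thesis using minA by (intro exI[of _ ?A] conjI disjI1 exI[of _ k])
  qed
qed

text \<open>The mirror image for a prime of the denominator, obtained by applying the previous lemma
  to \<open>prod.swap \<circ> C\<close> and swapping back.\<close>

lemma height_minimal_predecessor_swap:
  assumes C: "seq_fact P (Q * p) C" and min: "height_minimal P (Q * p) (entries C)"
    and PQ: "Rings.coprime P (Q * p)" "P > 0" "Q > 0" and p: "prime p"
    and small: "\<And>q. prime q \<Longrightarrow> q dvd P * (Q * p) \<Longrightarrow> p \<le> q"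
  shows "\<exists>A. seq_fact P Q A \<and> height_minimal P Q (entries A) \<and>
    ((\<exists>k. dn A k * p < nm A k \<and> C = A(k := (nm A k, dn A k * p))) \<or>
     (\<forall>k. \<not> dn A k * p < nm A k) \<and> C = A(fact_length A := (1, p)))"
proof -
  let ?s = "\<lambda>A :: fact_seq. prod.swap \<circ> A"
  have ss: "?s (?s A) = A" for A by (simp add: fun_eq_iff)
  have upd: "?s (A(k := v)) = (?s A)(k := prod.swap v)" for A k v by (simp add: fun_eq_iff)
  have "\<exists>A. seq_fact Q P A \<and> height_minimal Q P (entries A) \<and>
    ((\<exists>k. nm A k * p < dn A k \<and> ?s C = A(k := (nm A k * p, dn A k))) \<or>
     (\<forall>k. \<not> nm A k * p < dn A k) \<and> ?s C = A(fact_length A := (p, 1)))"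
  proof (rule height_minimal_predecessor)
    show "Rings.coprime (Q * p) P" using PQ(1) by (subst algebraic_semidom_class.coprime_commute)
    show "p \<le> q" if "prime q" "q dvd Q * p * P" for q
      using small that by (simp add: mult.commute)
  qed (use C min PQ p in simp_all)
  then obtain A where A: "seq_fact Q P A" "height_minimal Q P (entries A)"
    "(\<exists>k. nm A k * p < dn A k \<and> ?s C = A(k := (nm A k * p, dn A k))) \<or>
     (\<forall>k. \<not> nm A k * p < dn A k) \<and> ?s C = A(fact_length A := (p, 1))"
    by blast
  have C_eq: "C = (?s A)(k := prod.swap v)" if v: "?s C = A(k := v)" for k v
    using ss[of C] unfolding v upd by simp
  from A(3) have "(\<exists>k. nm A k * p < dn A k \<and> C = (?s A)(k := (dn A k, nm A k * p))) \<or>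
     (\<forall>k. \<not> nm A k * p < dn A k) \<and> C = (?s A)(fact_length A := (1, p))"
  proof (elim disjE exE conjE)
    fix k assume "nm A k * p < dn A k" "?s C = A(k := (nm A k * p, dn A k))"
    then show ?thesis using C_eq by (metis swap_simp)
  next
    assume "\<forall>k. \<not> nm A k * p < dn A k" "?s C = A(fact_length A := (p, 1))"
    then show ?thesis using C_eq by (metis swap_simp)
  qed
  then show ?thesis using A(1,2) by (intro exI[of _ "?s A"]) simp
qed

section \<open>Canonical trees\<close>

text \<open>Together with \<open>den_part\<close> this gives \<open>partial\<close> in lowest terms,
  see \<open>partial_eq\<close> and \<open>coprime_num_den_part\<close>.\<close>

definition num_part :: "rat \<Rightarrow> nat \<Rightarrow> nat" where
  "num_part \<alpha> n = (\<Prod>i<n. if primes_of \<alpha> ! i dvd num \<alpha> then primes_of \<alpha> ! i else 1)"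

definition den_part :: "rat \<Rightarrow> nat \<Rightarrow> nat" where
  "den_part \<alpha> n = (\<Prod>i<n. if primes_of \<alpha> ! i dvd num \<alpha> then 1 else primes_of \<alpha> ! i)"

lemma prime_primes_of: "i < num_primes \<alpha> \<Longrightarrow> prime (primes_of \<alpha> ! i)"
proof -
  assume "i < num_primes \<alpha>"
  then have "primes_of \<alpha> ! i \<in> set (primes_of \<alpha>)" by (simp add: num_primes_def)
  then show ?thesis by (auto simp: primes_of_def in_prime_factors_iff)
qed

lemma primes_of_antimono: "i \<le> j \<Longrightarrow> j < num_primes \<alpha> \<Longrightarrow> primes_of \<alpha> ! j \<le> primes_of \<alpha> ! i"
proof -
  assume "i \<le> j" "j < num_primes \<alpha>"
  moreover have "sorted (rev (primes_of \<alpha>))"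
    by (simp add: primes_of_def)
  ultimately show ?thesis
    using sorted_rev_nth_mono[of "primes_of \<alpha>" i j] by (simp add: num_primes_def)
qed

lemma part_mult: "num_part \<alpha> n * den_part \<alpha> n = (\<Prod>i<n. primes_of \<alpha> ! i)"
  unfolding num_part_def den_part_def prod.distrib[symmetric] by (intro prod.cong) auto

lemma num_den_part_pos:
  assumes "n \<le> num_primes \<alpha>"
  shows "num_part \<alpha> n > 0" "den_part \<alpha> n > 0"
  using assms prime_gt_0_nat[OF prime_primes_of, of _ \<alpha>]
  unfolding num_part_def den_part_def by (auto intro!: prod_pos)

text \<open>The side of a prime depends only on its value, so equal primes never land on different
  sides, and distinct primes are coprime.\<close>

lemma coprime_num_den_part:
  assumes "n \<le> num_primes \<alpha>"
  shows "Rings.coprime (num_part \<alpha> n) (den_part \<alpha> n)"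
  unfolding num_part_def den_part_def
proof (intro prod_coprime_left prod_coprime_right)
  fix i j assume ij: "i \<in> {..<n}" "j \<in> {..<n}"
  then have "prime (primes_of \<alpha> ! i)" "prime (primes_of \<alpha> ! j)" using assms prime_primes_of by auto
  then show "Rings.coprime (if primes_of \<alpha> ! i dvd num \<alpha> then primes_of \<alpha> ! i else 1)
     (if primes_of \<alpha> ! j dvd num \<alpha> then 1 else primes_of \<alpha> ! j)"
    using primes_coprime[of "primes_of \<alpha> ! i" "primes_of \<alpha> ! j"]
    by (cases "primes_of \<alpha> ! i = primes_of \<alpha> ! j") auto
qed

lemma partial_eq: "partial \<alpha> n = of_nat (num_part \<alpha> n) / of_nat (den_part \<alpha> n)"
  unfolding partial_def num_part_def den_part_def of_nat_prod prod_dividef[symmetric]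
  by (intro prod.cong) (auto simp: gamma_exp_def power_int_minus divide_simps)

lemma factorization_partial_iff:
  "n \<le> num_primes \<alpha> \<Longrightarrow>
    factorization (partial \<alpha> n) A \<longleftrightarrow> seq_fact (num_part \<alpha> n) (den_part \<alpha> n) A"
  unfolding partial_eq
  by (rule factorization_iff_seq_fact) (simp_all add: coprime_num_den_part num_den_part_pos)

text \<open>The primes are listed in nonincreasing order, so the newest one is the least. This
  supplies the leastness assumption of the predecessor lemmas.\<close>

lemma prime_dvd_part_ge:
  assumes "n < num_primes \<alpha>" "prime q" "q dvd num_part \<alpha> (Suc n) * den_part \<alpha> (Suc n)"
  shows "primes_of \<alpha> ! n \<le> q"
proof -
  obtain i where i: "i \<le> n" "q dvd primes_of \<alpha> ! i"
    using assms(2,3)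
    unfolding part_mult by (subst (asm) prime_dvd_prod_iff) (auto simp: less_Suc_eq_le)
  then have "q = primes_of \<alpha> ! i"
    using primes_dvd_imp_eq[OF assms(2) prime_primes_of] assms(1) by simp
  then show ?thesis using primes_of_antimono[OF i(1) assms(1)] by simp
qed

lemma height_minimal_partial_predecessor:
  assumes n: "n < num_primes \<alpha>"
    and C: "seq_fact (num_part \<alpha> (Suc n)) (den_part \<alpha> (Suc n)) C"
      "height_minimal (num_part \<alpha> (Suc n)) (den_part \<alpha> (Suc n)) (entries C)"
  obtains A where "seq_fact (num_part \<alpha> n) (den_part \<alpha> n) A"
    "height_minimal (num_part \<alpha> n) (den_part \<alpha> n) (entries A)"
    "C \<in> (if delta \<alpha> n A \<noteq> {} then delta \<alpha> n A else epsilon \<alpha> n A)"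
proof -
  let ?p = "primes_of \<alpha> ! n"
  have p: "prime ?p" using prime_primes_of[OF n] .
  have pos: "num_part \<alpha> n > 0" "den_part \<alpha> n > 0" using num_den_part_pos n by simp_all
  note small = prime_dvd_part_ge[OF n]
  have cop: "Rings.coprime (num_part \<alpha> (Suc n)) (den_part \<alpha> (Suc n))"
    using coprime_num_den_part n by simp
  show thesis
  proof (cases "?p dvd num \<alpha>")
    case True
    have eq: "num_part \<alpha> (Suc n) = num_part \<alpha> n * ?p" "den_part \<alpha> (Suc n) = den_part \<alpha> n"
      using True by (simp_all add: num_part_def den_part_def)
    obtain A where A: "seq_fact (num_part \<alpha> n) (den_part \<alpha> n) A"
      "height_minimal (num_part \<alpha> n) (den_part \<alpha> n) (entries A)"
      "(\<exists>k. nm A k * ?p < dn A k \<and> C = A(k := (nm A k * ?p, dn A k))) \<or>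
       (\<forall>k. \<not> nm A k * ?p < dn A k) \<and> C = A(fact_length A := (?p, 1))"
      using height_minimal_predecessor[OF C[unfolded eq] cop[unfolded eq] pos p small[unfolded eq]]
      by blast
    \<comment> \<open>The first alternative puts \<open>C\<close> into \<open>delta\<close>; the
      second says that \<open>delta\<close> is empty and \<open>C\<close> lies in
      \<open>epsilon\<close>.\<close>
    then have "C \<in> (if delta \<alpha> n A \<noteq> {} then delta \<alpha> n A else epsilon \<alpha> n A)"
      using True by (auto simp: delta_def epsilon_def Let_def)
    with A that show thesis by blast
  next
    case False
    have eq: "num_part \<alpha> (Suc n) = num_part \<alpha> n" "den_part \<alpha> (Suc n) = den_part \<alpha> n * ?p"
      using False by (simp_all add: num_part_def den_part_def)
    obtain A where A: "seq_fact (num_part \<alpha> n) (den_part \<alpha> n) A"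
      "height_minimal (num_part \<alpha> n) (den_part \<alpha> n) (entries A)"
      "(\<exists>k. dn A k * ?p < nm A k \<and> C = A(k := (nm A k, dn A k * ?p))) \<or>
       (\<forall>k. \<not> dn A k * ?p < nm A k) \<and> C = A(fact_length A := (1, ?p))"
      using height_minimal_predecessor_swap[OF C[unfolded eq] cop[unfolded eq] pos p small[unfolded eq]]
      by blast
    then have "C \<in> (if delta \<alpha> n A \<noteq> {} then delta \<alpha> n A else epsilon \<alpha> n A)"
      using False by (auto simp: delta_def epsilon_def Let_def)
    with A that show thesis by blast
  qed
qed

section \<open>Minimal factorizations occur in the canonical tree\<close>

lemma seq_fact_one: "seq_fact 1 1 A \<longleftrightarrow> A = one_seq"
proof
  assume A: "seq_fact 1 1 A"
  show "A = one_seq"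
  proof
    fix i
    show "A i = one_seq i" using seq_fact_dvd[OF A, of i] by (cases "A i") (simp add: one_seq_def)
  qed
next
  assume "A = one_seq"
  then show "seq_fact 1 1 A"
    by (simp add: seq_fact_def one_seq_def supp_def entries_def admissible_def)
qed

text \<open>A path between different vertices has at least two vertices, so index 1 is within its
  bounds.\<close>

lemma parent_in_verts:
  assumes "rooted_tree T r0" "r \<in> verts T" "r \<noteq> r0"
  shows "parent T r0 r \<in> verts T"
proof -
  define p where "p = (THE p. vpath p T \<and> hd p = r \<and> last p = r0)"
  have "\<exists>!p. vpath p T \<and> hd p = r \<and> last p = r0" using assms by (auto simp: rooted_tree_def)
  from theI'[OF this] have p: "vpath p T" "hd p = r" "last p = r0" by (simp_all add: p_def)
  then have "p \<noteq> []" "set p \<subseteq> verts T" by (auto simp: vpath_def vwalk_def)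
  moreover have "length p > 1"
    using p(2,3) \<open>p \<noteq> []\<close> assms(3) by (cases p rule: list.exhaust; cases "tl p") auto
  ultimately show ?thesis unfolding parent_def p_def[symmetric] by (meson nth_mem subsetD)
qed

text \<open>Induction on the number of primes: a predecessor of \<open>C\<close> already labels a
  vertex, and the children of that vertex realise every sequence that the growth rule allows, among
  them \<open>C\<close>.\<close>

lemma height_minimal_in_canonical_tree:
  assumes tree: "canonical_optimal_factorization_tree \<alpha> T r0 \<nu>"
    and "n \<le> num_primes \<alpha>" "seq_fact (num_part \<alpha> n) (den_part \<alpha> n) C"
      "height_minimal (num_part \<alpha> n) (den_part \<alpha> n) (entries C)"
  shows "C \<in> \<nu> ` verts T"
proof -
  have ft: "factorization_tree \<alpha> T r0 \<nu>"
    using tree unfolding canonical_optimal_factorization_tree_def by blast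
  show ?thesis
    using assms(2-)
  proof (induction n arbitrary: C)
    case 0
    have "seq_fact 1 1 C" using 0(2) by (simp add: num_part_def den_part_def)
    then have "C = one_seq" by (simp only: seq_fact_one)
    moreover have "r0 \<in> verts T" "\<nu> r0 = one_seq"
      using ft unfolding factorization_tree_def rooted_tree_def by blast+
    ultimately show ?case by (metis imageI)
  next
    case (Suc n)
    then have n: "n < num_primes \<alpha>" by simp
    obtain A where A: "seq_fact (num_part \<alpha> n) (den_part \<alpha> n) A"
      "height_minimal (num_part \<alpha> n) (den_part \<alpha> n) (entries A)"
      "C \<in> (if delta \<alpha> n A \<noteq> {} then delta \<alpha> n A else epsilon \<alpha> n A)"
      using height_minimal_partial_predecessor[OF n Suc.prems(2,3)] by blast
    then obtain r where r: "r \<in> verts T" "A = \<nu> r"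
      using Suc.IH[of A] n by (auto simp only: less_imp_le)
    have fact: "factorization (partial \<alpha> n) (\<nu> r)" using A(1) r n factorization_partial_iff by simp
    \<comment> \<open>Since \<open>n < num_primes \<alpha>\<close>, the vertex is not a leaf, so the
      canonical rule applies to it.\<close>
    then have "children T r0 r \<noteq> {}"
      using ft r n unfolding factorization_tree_def by blast
    then have "\<nu> ` children T r0 r = (if delta \<alpha> n A \<noteq> {} then delta \<alpha> n A else epsilon \<alpha> n A)"
      using tree r n fact unfolding canonical_optimal_factorization_tree_def by blast
    then have "C \<in> \<nu> ` children T r0 r" using A(3) by simp
    moreover have "children T r0 r \<subseteq> verts T" by (auto simp: children_def)
    ultimately show ?case by blast
  qed
qed

section \<open>Primitivity of the labels\<close>

lemma delta_primitive:
  assumes "\<And>i. prime (max (nm A i) (dn A i)) \<or> max (nm A i) (dn A i) = 1" "C \<in> delta \<alpha> n A"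
    and "primes_of \<alpha> ! n > 0"
  shows "prime (max (nm C i) (dn C i)) \<or> max (nm C i) (dn C i) = 1"
proof -
  \<comment> \<open>The changed side was the smaller one before and stays so afterwards; hence no
    maximum changes.\<close>
  have less: "a < b" if "a * primes_of \<alpha> ! n < b" for a b :: nat
  proof -
    have "a * 1 \<le> a * primes_of \<alpha> ! n" using assms(3) by (intro mult_le_mono) auto
    then show ?thesis using that by linarith
  qed
  from assms(2) consider
      k where "C = A(k := (nm A k * primes_of \<alpha> ! n, dn A k))" "nm A k * primes_of \<alpha> ! n < dn A k"
    | k where "C = A(k := (nm A k, dn A k * primes_of \<alpha> ! n))" "dn A k * primes_of \<alpha> ! n < nm A k"
    unfolding delta_def Let_def by (auto split: if_splits)
  then have "max (nm C i) (dn C i) = max (nm A i) (dn A i)"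
  proof cases
    case (1 k)
    then show ?thesis using less[OF 1(2)] by (cases "i = k") simp_all
  next
    case (2 k)
    then show ?thesis using less[OF 2(2)] by (cases "i = k") simp_all
  qed
  then show ?thesis using assms(1) by simp
qed

lemma epsilon_primitive:
  assumes "\<And>i. prime (max (nm A i) (dn A i)) \<or> max (nm A i) (dn A i) = 1" "C \<in> epsilon \<alpha> n A"
    and p: "prime (primes_of \<alpha> ! n)"
  shows "prime (max (nm C i) (dn C i)) \<or> max (nm C i) (dn C i) = 1"
proof -
  have "max (primes_of \<alpha> ! n) 1 = primes_of \<alpha> ! n" "max 1 (primes_of \<alpha> ! n) = primes_of \<alpha> ! n"
    using prime_gt_1_nat[OF p] by auto
  then show ?thesis
    using assms by (auto simp: epsilon_def Let_def split: if_splits)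
qed

text \<open>Primitivity passes from parent to child. The induction measure is the product of the
  first \<open>n\<close> primes, which is read off from the label and drops on passing to the
  parent.\<close>

lemma canonical_tree_primitive:
  assumes tree: "canonical_optimal_factorization_tree \<alpha> T r0 \<nu>"
    and "n \<le> num_primes \<alpha>" "r \<in> verts T" "seq_fact (num_part \<alpha> n) (den_part \<alpha> n) (\<nu> r)"
  shows "prime (max (nm (\<nu> r) i) (dn (\<nu> r) i)) \<or> max (nm (\<nu> r) i) (dn (\<nu> r) i) = 1"
  using assms(2-)
proof (induction "num_part \<alpha> n * den_part \<alpha> n" arbitrary: n r i rule: less_induct)
  case less
  have ft: "factorization_tree \<alpha> T r0 \<nu>"
    using tree unfolding canonical_optimal_factorization_tree_def by blast
  show ?case
  proof (cases "r = r0")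
    case True
    then have "\<nu> r = one_seq" using ft unfolding factorization_tree_def by blast
    then show ?thesis by (simp add: one_seq_def)
  next
    case False
    let ?s = "parent T r0 r"
    have s: "?s \<in> verts T"
      using parent_in_verts[OF _ less.prems(2) False] ft unfolding factorization_tree_def by blast
    have "direct_subfactorization \<alpha> (\<nu> ?s) (\<nu> r)"
      using ft less.prems(2) False unfolding factorization_tree_def by blast
    then obtain m where m: "m < num_primes \<alpha>" "factorization (partial \<alpha> m) (\<nu> ?s)"
      "factorization (partial \<alpha> (Suc m)) (\<nu> r)"
      unfolding direct_subfactorization_def Let_def by blast
    have p: "prime (primes_of \<alpha> ! m)" using prime_primes_of m by blast
    have "seq_fact (num_part \<alpha> (Suc m)) (den_part \<alpha> (Suc m)) (\<nu> r)"
      using m factorization_partial_iff by simp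
    \<comment> \<open>Both levels describe the same label, whose entries determine the two
      products.\<close>
    then have eq: "num_part \<alpha> (Suc m) = num_part \<alpha> n" "den_part \<alpha> (Suc m) = den_part \<alpha> n"
      using less.prems(3) by (simp_all add: seq_fact_def admissible_def)
    have "num_part \<alpha> n * den_part \<alpha> n = num_part \<alpha> m * den_part \<alpha> m * primes_of \<alpha> ! m"
      unfolding eq[symmetric] part_mult by simp
    moreover have "num_part \<alpha> m * den_part \<alpha> m > 0" using num_den_part_pos[of m \<alpha>] m(1) by simp
    ultimately have "num_part \<alpha> m * den_part \<alpha> m < num_part \<alpha> n * den_part \<alpha> n"
      using prime_gt_1_nat[OF p] by simp
    then have IH: "prime (max (nm (\<nu> ?s) i) (dn (\<nu> ?s) i)) \<or> max (nm (\<nu> ?s) i) (dn (\<nu> ?s) i) = 1" for i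
      using less.hyps[of m ?s i] m s factorization_partial_iff by simp
    have "r \<in> children T r0 ?s" using less.prems False by (simp add: children_def)
    then have "\<nu> r \<in> (if delta \<alpha> m (\<nu> ?s) \<noteq> {} then delta \<alpha> m (\<nu> ?s) else epsilon \<alpha> m (\<nu> ?s))"
      using tree s m unfolding canonical_optimal_factorization_tree_def by blast
    then show ?thesis
      using delta_primitive[OF IH] epsilon_primitive[OF IH] p prime_gt_0_nat[OF p]
      by (auto split: if_splits)
  qed
qed

theorem theorem2p10:
  fixes \<alpha> :: rat
    and T :: "('v, 'e) pre_digraph"
    and r0 :: 'v
    and \<nu> :: "'v \<Rightarrow> fact_seq"
  assumes "\<alpha> > 0"
    and "canonical_optimal_factorization_tree \<alpha> T r0 \<nu>"
  shows "optimal_factorization_tree \<alpha> T r0 \<nu> \<and> primitive_factorization_tree \<alpha> T r0 \<nu>"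
proof
  have ft: "factorization_tree \<alpha> T r0 \<nu>"
    using assms(2) unfolding canonical_optimal_factorization_tree_def by blast
  \<comment> \<open>Optimality enters only through minimality of heights, which is the property that
    descends to the root.\<close>
  have "A \<in> \<nu> ` verts T" if A: "A \<in> optimal_facts \<alpha>" for A
  proof -
    obtain n where n: "n \<le> num_primes \<alpha>" and opt: "optimal_factorization (partial \<alpha> n) A"
      using A by (auto simp: optimal_facts_def)
    have "seq_fact (num_part \<alpha> n) (den_part \<alpha> n) A"
      using opt factorization_partial_iff[OF n] by (simp add: optimal_factorization_def)
    moreover have "height_minimal (num_part \<alpha> n) (den_part \<alpha> n) (entries A)"
      using optimal_imp_height_minimal[OF coprime_num_den_part num_den_part_pos] n opt
      unfolding partial_eq by blast
    ultimately show ?thesis by (rule height_minimal_in_canonical_tree[OF assms(2) n])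
  qed
  then show "optimal_factorization_tree \<alpha> T r0 \<nu>"
    using ft unfolding optimal_factorization_tree_def by blast
  have "\<nu> r \<in> primitive_facts \<alpha>" if r: "r \<in> verts T" for r
  proof -
    obtain n where n: "n \<le> num_primes \<alpha>" and fact: "factorization (partial \<alpha> n) (\<nu> r)"
      using ft r unfolding factorization_tree_def all_facts_def by blast
    then have "seq_fact (num_part \<alpha> n) (den_part \<alpha> n) (\<nu> r)"
      using factorization_partial_iff by blast
    then show ?thesis
      using canonical_tree_primitive[OF assms(2) n r] n fact
      by (auto simp: primitive_facts_def primitive_factorization_def)
  qed
  then show "primitive_factorization_tree \<alpha> T r0 \<nu>"
    using ft unfolding primitive_factorization_tree_def by blast
qed

end
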